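(* Let $(S,+)$ be a commutative semigroup, let $F$ be a finite nonempty subset of $S$, and let $M$ be a piecewise syndetic subset of $S$. Then the set $\{(a,n)\in S\times\mathbb{N} : a+n\cdot F\subseteq M\}$ is piecewise syndetic in $(S\times\mathbb{N},+)$.
   Context: $\mathbb{N}$ denotes the set of positive integers. For a commutative semigroup $(T,+)$, $A\subseteq T$ and $t\in T$, put $-t+A=\{s\in T : t+s\in A\}$. A set $A\subseteq T$ is thick in $T$ if for every finite nonempty set $E\subseteq T$ there exists $x\in T$ such that $E+x\subseteq A$. A set $A\subseteq T$ is piecewise syndetic in $T$ if there exists a finite nonempty set $G\subseteq T$ such that $\bigcup_{t\in G}(-t+A)$ is thick in $T$. For $x\in S$ and $n\in\mathbb{N}$, $n\cdot x$ is the sum of $x$ with itself $n$ times, and for $a\in S$ and $F\subseteq S$, $a+n\cdot F=\{a+n\cdot x : x\in F\}$. The set $S\times\mathbb{N}$ is a commutative semigroup under the operation $(s_1,n_1)+(s_2,n_2)=(s_1+s_2,n_1+n_2)$. *)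

theory Defs
  imports Main "HOL-Library.Product_Plus"
begin

text \<open>
  A commutative semigroup is represented as a carrier set \<open>T\<close> closed under the addition of a type of
  class \<open>ab_semigroup_add\<close>; taking \<open>T = UNIV\<close> gives the type itself. The carrier is needed because
  the positive integers are a subsemigroup of \<^typ>\<open>nat\<close>, which contains \<open>0\<close>. Addition on products
  is componentwise, from \<^theory>\<open>HOL-Library.Product_Plus\<close>.
\<close>

definition translate_back :: "'a::ab_semigroup_add set \<Rightarrow> 'a \<Rightarrow> 'a set \<Rightarrow> 'a set" where
  "translate_back T t A = {s \<in> T. t + s \<in> A}"

definition thick_in :: "'a::ab_semigroup_add set \<Rightarrow> 'a set \<Rightarrow> bool" where
  "thick_in T A \<longleftrightarrow> A \<subseteq> T \<and>
     (\<forall>E. finite E \<and> E \<noteq> {} \<and> E \<subseteq> T \<longrightarrow> (\<exists>x\<in>T. (\<lambda>e. e + x) ` E \<subseteq> A))"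

definition piecewise_syndetic_in :: "'a::ab_semigroup_add set \<Rightarrow> 'a set \<Rightarrow> bool" where
  "piecewise_syndetic_in T A \<longleftrightarrow> A \<subseteq> T \<and>
     (\<exists>G. finite G \<and> G \<noteq> {} \<and> G \<subseteq> T \<and> thick_in T (\<Union>t\<in>G. translate_back T t A))"

text \<open>
  The sum of \<open>n\<close> copies of \<open>x\<close>, meaningful only for \<open>n \<ge> 1\<close> since a semigroup need not have a zero
  (for \<open>n = 0\<close> the value is \<open>x\<close> by truncated subtraction).
\<close>

definition nsum :: "nat \<Rightarrow> 'a::ab_semigroup_add \<Rightarrow> 'a" where
  "nsum n x = (((+) x) ^^ (n - 1)) x"

end

theory Submission
  imports Defs
begin

text \<open>
  Let \<open>R\<close> be the larger semigroup of all \<open>(a, n)\<close> with \<open>a \<in> S\<close> and \<open>n \<ge> 0\<close>. Each \<open>f \<in> F\<close> gives a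
  homomorphism \<open>\<phi> f (a, n) = a + n f\<close> from \<open>R\<close> to \<open>S\<close> (with \<open>\<phi> f (a, 0) = a\<close>), and all of these
  have the common section \<open>\<delta> a = (a, 0)\<close>. It suffices to show that
  \<open>{u \<in> R. \<forall>f\<in>F. \<phi> f u \<in> M}\<close> is piecewise syndetic in \<open>R\<close>: the pairs with \<open>n \<ge> 1\<close> form an ideal
  of \<open>R\<close>, and intersecting with an ideal preserves piecewise syndeticity
  (\<open>piecewise_syndetic_in_ideal\<close>). Only the homomorphisms and their section matter for the main
  claim, so it is proved for every such family, in the locale \<open>retraction_family\<close>.

  Call a set small if it is not piecewise syndetic. Small sets form a proper translation-invariant
  ideal of sets, and an ultrafilter that contains no small set keeps this property when it is added,
  on either side, to any ultrafilter on \<open>R\<close>. Here \<open>P\<close> holds eventually for \<open>u + v\<close> if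
  \<open>\<forall>\<^sub>F x in u. \<forall>\<^sub>F y in v. P (x + y)\<close>. In the language of the Stone-Cech compactification, the
  ultrafilters avoiding small sets form a two-sided ideal.

  The heart is \<open>monochromatic_not_small\<close>: for every finite colouring of \<open>S\<close>, the set of those
  \<open>u \<in> R\<close> whose images \<open>\<phi> f u\<close> (\<open>f \<in> F\<close>) all have one colour is piecewise syndetic. The proof is by
  induction on \<open>F\<close>. The claim for \<open>F\<close> and all colourings yields, by compactness, an ultrafilter \<open>q\<close>
  on \<open>R\<close> that avoids small sets and has the same image \<open>p\<close> under every \<open>\<phi> f\<close> with \<open>f \<in> F\<close>. Let
  \<open>p'\<close> be its image under a new map \<open>\<phi> f0\<close>. Among the ultrafilters
  \<open>w j = p + \<dots> + p + p' + \<dots> + p'\<close>, with \<open>j\<close> copies of \<open>p\<close> and \<open>r\<close> summands in total, two have the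
  same colour if \<open>r\<close> is large, say \<open>w j\<close> and \<open>w l\<close> with \<open>j < l\<close>. Then
  the sum \<open>v\<close> of \<open>j\<close> copies of \<open>\<delta> p\<close>, then \<open>l - j\<close> copies of \<open>q\<close>, then \<open>r - l\<close> copies of \<open>\<delta> p'\<close>
  has image \<open>w l\<close> under \<open>\<phi> f\<close> for \<open>f \<in> F\<close> and image \<open>w j\<close> under \<open>\<phi> f0\<close>, so \<open>v\<close> contains the set
  of \<open>u\<close> with all images of one colour. As \<open>q\<close> occurs in the sum, \<open>v\<close> contains no small set;
  hence that set is not small.

  To reach \<open>M\<close> from a colouring, take a finite \<open>G\<close> such that the union \<open>T\<close> of the translates
  \<open>-t + M\<close>, \<open>t \<in> G\<close>, is thick, and an ultrafilter \<open>p\<close> on \<open>S\<close> with \<open>\<forall>\<^sub>F y in p. s + y \<in> T\<close> for all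
  \<open>s \<in> S\<close>. Colour \<open>s\<close> by those \<open>t \<in> G\<close> with \<open>\<forall>\<^sub>F y in p. t + s + y \<in> M\<close>. If all \<open>\<phi> f u\<close> have the
  colour \<open>t\<close>, then \<open>u + \<delta> y + \<delta> t\<close> has all its images in \<open>M\<close> for most \<open>y\<close>; so if the elements with
  all images in \<open>M\<close> formed a small set, the monochromatic \<open>u\<close> would form a small set too
  (\<open>piecewise_syndetic_common_preimage\<close>).
\<close>

section \<open>Ultrafilters\<close>

definition ultrafilter :: "'a filter \<Rightarrow> bool" where
  "ultrafilter U \<longleftrightarrow> U \<noteq> bot \<and> (\<forall>P. eventually P U \<or> eventually (\<lambda>x. \<not> P x) U)"

lemma ultrafilter_not_eventually:
  assumes "ultrafilter U"
  shows "eventually (\<lambda>x. \<not> P x) U \<longleftrightarrow> \<not> eventually P U"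
proof
  assume *: "eventually (\<lambda>x. \<not> P x) U"
  show "\<not> eventually P U"
  proof
    assume "eventually P U"
    with * have "eventually (\<lambda>x. False) U" by eventually_elim simp
    with assms show False by (simp add: ultrafilter_def)
  qed
next
  assume "\<not> eventually P U"
  with assms show "eventually (\<lambda>x. \<not> P x) U" by (auto simp: ultrafilter_def)
qed

lemma ultrafilterI:
  assumes "\<And>P. eventually (\<lambda>x. \<not> P x) U \<longleftrightarrow> \<not> eventually P U"
  shows "ultrafilter U"
  unfolding ultrafilter_def
proof (intro conjI allI)
  show "U \<noteq> bot" using assms[of "\<lambda>_. False"] by auto
  fix P show "eventually P U \<or> eventually (\<lambda>x. \<not> P x) U" using assms by auto
qed

lemma ultrafilter_filtermap: "ultrafilter U \<Longrightarrow> ultrafilter (filtermap f U)"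
  by (intro ultrafilterI) (simp add: eventually_filtermap ultrafilter_not_eventually)

lemma ultrafilter_finite_Bex:
  assumes U: "ultrafilter U" and "finite G" and ev: "eventually (\<lambda>x. \<exists>t\<in>G. P t x) U"
  shows "\<exists>t\<in>G. eventually (P t) U"
proof (rule ccontr)
  assume "\<not> ?thesis"
  then have "\<forall>t\<in>G. eventually (\<lambda>x. \<not> P t x) U" by (simp add: ultrafilter_not_eventually[OF U])
  then have "eventually (\<lambda>x. \<forall>t\<in>G. \<not> P t x) U" using \<open>finite G\<close> by (simp add: eventually_ball_finite)
  then have "eventually (\<lambda>x. \<not> (\<exists>t\<in>G. P t x)) U" by simp
  with ev show False using ultrafilter_not_eventually[OF U] by blast
qed

text \<open>
  By Zorn's lemma there is a minimal proper filter below \<open>F\<close>. It decides every \<open>P\<close>: if adjoining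
  \<open>P\<close> keeps it proper, then minimality says that \<open>P\<close> held already, and otherwise the negation holds.
\<close>

lemma ultrafilter_refines:
  assumes "F \<noteq> bot"
  obtains U where "ultrafilter U" "U \<le> F"
proof -
  define A where "A = {G. G \<noteq> bot \<and> G \<le> F}"
  have po: "partial_order_on A (relation_of (\<ge>) A)"
    by (auto simp: partial_order_on_def preorder_on_def refl_on_def trans_def antisym_def relation_of_def)
  have "\<exists>U\<in>A. \<forall>G\<in>A. U \<ge> G \<longrightarrow> G = U"
  proof (rule predicate_Zorn[OF po])
    fix C assume C: "C \<in> Chains (relation_of (\<ge>) A)"
    then have CA: "G \<in> A" if "G \<in> C" for G using that by (auto simp: Chains_def relation_of_def)
    show "\<exists>u\<in>A. \<forall>a\<in>C. a \<ge> u"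
    proof (cases "C = {}")
      case True then show ?thesis using assms by (auto simp: A_def)
    next
      case False
      have "\<exists>x\<in>C. x \<le> inf G H" if "G \<in> C" "H \<in> C" for G H
        using C that by (auto simp: Chains_def relation_of_def)
      then have "eventually (\<lambda>_. False) (Inf C) \<longleftrightarrow> (\<exists>b\<in>C. eventually (\<lambda>_. False) b)"
        using False by (intro eventually_Inf_base) auto
      then have "Inf C \<noteq> bot"
        using CA unfolding eventually_False A_def by blast
      moreover have "Inf C \<le> F"
      proof -
        obtain G where "G \<in> C" using False by blast
        then show ?thesis using CA by (auto simp: A_def intro: Inf_lower2)
      qed
      ultimately show ?thesis by (auto simp: A_def intro: Inf_lower)
    qed
  qed
  then obtain U where U: "U \<in> A" and max: "\<And>G. G \<in> A \<Longrightarrow> G \<le> U \<Longrightarrow> G = U" by auto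
  have "eventually P U \<or> eventually (\<lambda>x. \<not> P x) U" for P
  proof (cases "inf U (principal {x. P x}) = bot")
    case True
    then have "eventually (\<lambda>x. False) (inf U (principal {x. P x}))" by simp
    then show ?thesis by (simp add: eventually_inf_principal)
  next
    case False
    then have "inf U (principal {x. P x}) = U"
      using U by (intro max) (auto simp: A_def intro: le_infI1)
    then have "U \<le> principal {x. P x}" by (metis inf_le2)
    then show ?thesis by (simp add: le_principal)
  qed
  then have "ultrafilter U" using U by (auto simp: ultrafilter_def A_def)
  with that U show ?thesis by (auto simp: A_def)
qed

lemma ultrafilter_of_base:
  assumes "I \<noteq> {}"
    and directed: "\<And>i j. i \<in> I \<Longrightarrow> j \<in> I \<Longrightarrow> \<exists>k\<in>I. B k \<subseteq> B i \<inter> B j"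
    and nonempty: "\<And>i. i \<in> I \<Longrightarrow> B i \<noteq> {}"
  obtains U where "ultrafilter U" "\<And>i. i \<in> I \<Longrightarrow> eventually (\<lambda>x. x \<in> B i) U"
proof -
  define F where "F = (INF i\<in>I. principal (B i))"
  have "eventually P F \<longleftrightarrow> (\<exists>i\<in>I. eventually P (principal (B i)))" for P
    unfolding F_def using assms(1) directed by (intro eventually_INF_base) auto
  then have "\<not> eventually (\<lambda>_. False) F" using nonempty by (auto simp: eventually_principal)
  then have "F \<noteq> bot" by auto
  then obtain U where U: "ultrafilter U" "U \<le> F" by (rule ultrafilter_refines)
  have "eventually (\<lambda>x. x \<in> B i) U" if "i \<in> I" for i
    using U(2) that unfolding F_def le_principal[symmetric] by (metis (full_types) INF_lower2 order.refl order_trans)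
  with U(1) that show ?thesis by blast
qed

text \<open>
  On ultrafilters this is the addition of the Stone-Cech compactification. It need not be
  commutative, even when \<open>+\<close> is.
\<close>

definition filter_sum :: "'a::plus filter \<Rightarrow> 'a filter \<Rightarrow> 'a filter" where
  "filter_sum u v = Abs_filter (\<lambda>P. \<forall>\<^sub>F x in u. \<forall>\<^sub>F y in v. P (x + y))"

lemma eventually_filter_sum:
  "eventually P (filter_sum u v) \<longleftrightarrow> (\<forall>\<^sub>F x in u. \<forall>\<^sub>F y in v. P (x + y))"
  unfolding filter_sum_def
proof (rule eventually_Abs_filter, rule is_filter.intro)
  fix P Q
  assume "\<forall>\<^sub>F x in u. \<forall>\<^sub>F y in v. P (x + y)" "\<forall>\<^sub>F x in u. \<forall>\<^sub>F y in v. Q (x + y)"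
  then show "\<forall>\<^sub>F x in u. \<forall>\<^sub>F y in v. P (x + y) \<and> Q (x + y)"
    by eventually_elim (rule eventually_conj)
next
  fix P Q
  assume PQ: "\<forall>x. P x \<longrightarrow> Q x" and P: "\<forall>\<^sub>F x in u. \<forall>\<^sub>F y in v. P (x + y)"
  from P show "\<forall>\<^sub>F x in u. \<forall>\<^sub>F y in v. Q (x + y)"
    by (rule eventually_mono) (erule eventually_mono, use PQ in blast)
qed simp

lemma ultrafilter_filter_sum:
  "ultrafilter u \<Longrightarrow> ultrafilter v \<Longrightarrow> ultrafilter (filter_sum u v)"
  by (intro ultrafilterI) (simp add: eventually_filter_sum ultrafilter_not_eventually)

text \<open>
  A semigroup need not have a zero, so one-element lists form a base case of their own; the value
  at the empty list is a dummy.
\<close>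

fun filter_sum_list :: "'a::plus filter list \<Rightarrow> 'a filter" where
  "filter_sum_list [] = bot"
| "filter_sum_list [u] = u"
| "filter_sum_list (u # v # us) = filter_sum u (filter_sum_list (v # us))"

lemma ultrafilter_filter_sum_list:
  "us \<noteq> [] \<Longrightarrow> (\<And>u. u \<in> set us \<Longrightarrow> ultrafilter u) \<Longrightarrow> ultrafilter (filter_sum_list us)"
  by (induction us rule: filter_sum_list.induct) (auto intro: ultrafilter_filter_sum)


section \<open>Subsemigroups and sets that are not piecewise syndetic\<close>

locale comm_subsemigroup =
  fixes R :: "'b::ab_semigroup_add set"
  assumes closed: "x \<in> R \<Longrightarrow> y \<in> R \<Longrightarrow> x + y \<in> R"
    and nonempty: "R \<noteq> {}"
begin

text \<open>
  The negation of piecewise syndeticity for \<open>A \<subseteq> R\<close>, in quantifier form. Unlike piecewise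
  syndeticity it makes sense for sets that leave \<open>R\<close>, so translates of \<open>A\<close> need not be cut down.
\<close>

definition small :: "'b set \<Rightarrow> bool" where
  "small A \<longleftrightarrow> (\<forall>H. finite H \<and> H \<subseteq> R \<longrightarrow>
     (\<exists>E. finite E \<and> E \<subseteq> R \<and> (\<forall>x\<in>R. \<exists>e\<in>E. \<forall>h\<in>H. h + (e + x) \<notin> A)))"

lemma smallE:
  assumes "small A" "finite H" "H \<subseteq> R"
  obtains E where "finite E" "E \<subseteq> R" "\<And>x. x \<in> R \<Longrightarrow> \<exists>e\<in>E. \<forall>h\<in>H. h + (e + x) \<notin> A"
  using assms unfolding small_def by meson

lemma not_piecewise_syndetic_iff_small:
  assumes "A \<subseteq> R"
  shows "\<not> piecewise_syndetic_in R A \<longleftrightarrow> small A"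
proof -
  obtain c where c: "c \<in> R" using nonempty by blast
  have translates: "e + x \<in> (\<Union>t\<in>H. translate_back R t A) \<longleftrightarrow> (\<exists>h\<in>H. h + (e + x) \<in> A)"
    if "e \<in> R" "x \<in> R" for e x H
    using that closed by (auto simp: translate_back_def)
  have sub: "(\<Union>t\<in>H. translate_back R t A) \<subseteq> R" for H
    by (auto simp: translate_back_def)
  show ?thesis
  proof
    assume nps: "\<not> piecewise_syndetic_in R A"
    show "small A"
      unfolding small_def
    proof (intro allI impI, elim conjE)
      fix H assume H: "finite H" "H \<subseteq> R"
      show "\<exists>E. finite E \<and> E \<subseteq> R \<and> (\<forall>x\<in>R. \<exists>e\<in>E. \<forall>h\<in>H. h + (e + x) \<notin> A)"
      proof (cases "H = {}")
        case True then show ?thesis using c by (intro exI[of _ "{c}"]) auto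
      next
        case False
        with nps H assms have "\<not> thick_in R (\<Union>t\<in>H. translate_back R t A)"
          by (auto simp: piecewise_syndetic_in_def)
        then obtain E where E: "finite E" "E \<subseteq> R"
          "\<forall>x\<in>R. \<not> (\<lambda>e. e + x) ` E \<subseteq> (\<Union>t\<in>H. translate_back R t A)"
          using sub[of H] unfolding thick_in_def by auto
        have "\<exists>e\<in>E. \<forall>h\<in>H. h + (e + x) \<notin> A" if x: "x \<in> R" for x
        proof -
          obtain e where e: "e \<in> E" "e + x \<notin> (\<Union>t\<in>H. translate_back R t A)"
            using bspec[OF E(3) x] by blast
          then have "\<forall>h\<in>H. h + (e + x) \<notin> A" using translates[OF subsetD[OF E(2) e(1)] x] by blast
          with e(1) show ?thesis by (rule bexI[rotated])
        qed
        then show ?thesis using E by blast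
      qed
    qed
  next
    assume sm: "small A"
    show "\<not> piecewise_syndetic_in R A"
    proof
      assume "piecewise_syndetic_in R A"
      then obtain G where G: "finite G" "G \<subseteq> R" "thick_in R (\<Union>t\<in>G. translate_back R t A)"
        by (auto simp: piecewise_syndetic_in_def)
      obtain E where E: "finite E" "E \<subseteq> R" "\<And>x. x \<in> R \<Longrightarrow> \<exists>e\<in>E. \<forall>h\<in>G. h + (e + x) \<notin> A"
        using smallE[OF sm G(1,2)] by blast
      have "E \<noteq> {}" using E(3)[OF c] by blast
      then obtain x where x: "x \<in> R" "(\<lambda>e. e + x) ` E \<subseteq> (\<Union>t\<in>G. translate_back R t A)"
        using G(3) E(1,2) unfolding thick_in_def by meson
      from E(3)[OF x(1)] obtain e where e: "e \<in> E" "\<forall>h\<in>G. h + (e + x) \<notin> A" by blast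
      moreover have "e + x \<in> (\<Union>t\<in>G. translate_back R t A)" using x(2) e(1) by blast
      ultimately show False using translates[OF subsetD[OF E(2) e(1)] x(1)] by blast
    qed
  qed
qed

lemma small_subset: "small A \<Longrightarrow> B \<subseteq> A \<Longrightarrow> small B"
  unfolding small_def by (meson subsetD)

text \<open>
  This is the partition regularity of piecewise syndetic sets. If \<open>E\<close> witnesses smallness of
  \<open>B\<close> for \<open>H\<close>, a bounded shift \<open>e'\<close> first makes the whole window \<open>H + E + e' + x\<close> disjoint from \<open>A\<close>.
  Then some \<open>e \<in> E\<close> makes \<open>H + e + e' + x\<close>, which lies in this window, disjoint from \<open>B\<close> too.
\<close>

lemma small_Un:
  assumes A: "small A" and B: "small B"
  shows "small (A \<union> B)"
  unfolding small_def
proof (intro allI impI, elim conjE)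
  fix H assume H: "finite H" "H \<subseteq> R"
  obtain E where E: "finite E" "E \<subseteq> R" "\<And>x. x \<in> R \<Longrightarrow> \<exists>e\<in>E. \<forall>h\<in>H. h + (e + x) \<notin> B"
    using smallE[OF B H] by blast
  let ?H' = "(\<lambda>(h, e). h + e) ` (H \<times> E)"
  have "finite ?H'" "?H' \<subseteq> R" using H E by (auto intro!: closed)
  then obtain E' where E': "finite E'" "E' \<subseteq> R" "\<And>x. x \<in> R \<Longrightarrow> \<exists>e\<in>E'. \<forall>h\<in>?H'. h + (e + x) \<notin> A"
    using smallE[OF A] by blast
  let ?E = "(\<lambda>(e, e'). e + e') ` (E \<times> E')"
  have "\<exists>e\<in>?E. \<forall>h\<in>H. h + (e + x) \<notin> A \<union> B" if x: "x \<in> R" for x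
  proof -
    obtain e' where e': "e' \<in> E'" "\<And>h e. h \<in> H \<Longrightarrow> e \<in> E \<Longrightarrow> (h + e) + (e' + x) \<notin> A"
      using E'(3)[OF x] by fastforce
    obtain e where e: "e \<in> E" "\<And>h. h \<in> H \<Longrightarrow> h + (e + (e' + x)) \<notin> B"
      using E(3)[of "e' + x"] closed x E'(2) e'(1) by blast
    have "h + ((e + e') + x) \<notin> A \<union> B" if "h \<in> H" for h
      using e'(2)[OF that e(1)] e(2)[OF that] by (simp add: add.assoc)
    then show ?thesis using e(1) e'(1) by force
  qed
  moreover have "finite ?E" "?E \<subseteq> R" using E E' by (auto intro!: closed)
  ultimately show "\<exists>E. finite E \<and> E \<subseteq> R \<and> (\<forall>x\<in>R. \<exists>e\<in>E. \<forall>h\<in>H. h + (e + x) \<notin> A \<union> B)"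
    by blast
qed

lemma small_empty: "small {}"
  using nonempty unfolding small_def by (metis empty_subsetI finite.intros insert_subset ex_in_conv insertI1)

lemma small_UN: "finite I \<Longrightarrow> (\<And>i. i \<in> I \<Longrightarrow> small (A i)) \<Longrightarrow> small (\<Union>i\<in>I. A i)"
  by (induction I rule: finite_induct) (auto intro: small_empty small_Un)

lemma not_small_carrier: "\<not> small R"
proof
  assume "small R"
  obtain c where c: "c \<in> R" using nonempty by blast
  have "\<exists>E. finite E \<and> E \<subseteq> R \<and> (\<forall>x\<in>R. \<exists>e\<in>E. \<forall>h\<in>{c}. h + (e + x) \<notin> R)"
    using \<open>small R\<close> c unfolding small_def by (elim allE[of _ "{c}"]) simp
  then obtain E where E: "E \<subseteq> R" "\<forall>x\<in>R. \<exists>e\<in>E. c + (e + x) \<notin> R" by auto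
  from bspec[OF E(2) c] obtain e where e: "e \<in> E" "c + (e + c) \<notin> R" by blast
  have "c + (e + c) \<in> R" using e(1) E(1) c by (auto intro!: closed)
  with e(2) show False by blast
qed

text \<open>
  The same finite set \<open>E\<close> that witnesses smallness of \<open>A\<close> for \<open>H\<close> works here. For each \<open>y \<in> R\<close> some
  \<open>e \<in> E\<close> makes \<open>H + e + (x + y)\<close> disjoint from \<open>A\<close>; were every \<open>e \<in> E\<close> to have an \<open>h \<in> H\<close> with
  \<open>h + e + x + y \<in> A\<close> for most \<open>y\<close>, then, \<open>E\<close> being finite, a single \<open>y\<close> would do this for all \<open>e\<close>.
\<close>

lemma small_eventually_translate:
  assumes "small A" "v \<noteq> bot" "eventually (\<lambda>y. y \<in> R) v"
  shows "small {u. eventually (\<lambda>y. u + y \<in> A) v}"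
  unfolding small_def
proof (intro allI impI, elim conjE)
  fix H assume H: "finite H" "H \<subseteq> R"
  obtain E where E: "finite E" "E \<subseteq> R" "\<And>x. x \<in> R \<Longrightarrow> \<exists>e\<in>E. \<forall>h\<in>H. h + (e + x) \<notin> A"
    using smallE[OF assms(1) H] by blast
  have "\<exists>e\<in>E. \<forall>h\<in>H. h + (e + x) \<notin> {u. eventually (\<lambda>y. u + y \<in> A) v}" if x: "x \<in> R" for x
  proof (rule ccontr)
    assume "\<not> ?thesis"
    then have "\<forall>e\<in>E. \<exists>h\<in>H. eventually (\<lambda>y. h + (e + x) + y \<in> A) v" by simp
    then have "\<forall>e\<in>E. \<exists>h. h \<in> H \<and> eventually (\<lambda>y. h + (e + x) + y \<in> A) v" by blast
    from bchoice[OF this] obtain h where h: "\<And>e. e \<in> E \<Longrightarrow> h e \<in> H"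
      "\<forall>e\<in>E. eventually (\<lambda>y. h e + (e + x) + y \<in> A) v" by blast
    have "eventually (\<lambda>y. \<forall>e\<in>E. h e + (e + x) + y \<in> A) v"
      using h(2) E(1) by (simp add: eventually_ball_finite)
    with assms(3) have "eventually (\<lambda>y. False) v"
    proof eventually_elim
      fix y assume y: "y \<in> R" "\<forall>e\<in>E. h e + (e + x) + y \<in> A"
      obtain e where "e \<in> E" "\<forall>h\<in>H. h + (e + (x + y)) \<notin> A" using E(3)[of "x + y"] closed x y by blast
      with y h(1) show False by (auto simp: add.assoc)
    qed
    with assms(2) show False by simp
  qed
  with E(1,2) show "\<exists>E. finite E \<and> E \<subseteq> R \<and> (\<forall>x\<in>R. \<exists>e\<in>E. \<forall>h\<in>H. h + (e + x) \<notin> {u. eventually (\<lambda>y. u + y \<in> A) v})"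
    by (intro exI[of _ E] conjI ballI)
qed

lemma small_translate:
  assumes "small A" "s \<in> R"
  shows "small {u. u + s \<in> A}"
  using small_eventually_translate[of A "principal {s}"] assms
  by (simp add: eventually_principal principal_eq_bot_iff)

text \<open>
  The ultrafilters on \<open>R\<close> with the following property are the points of the closure of the smallest ideal
  of the Stone-Cech compactification. The next two lemmas say that they form a two-sided ideal.
\<close>

definition avoids_small :: "'b filter \<Rightarrow> bool" where
  "avoids_small q \<longleftrightarrow> (\<forall>A. small A \<longrightarrow> \<not> eventually (\<lambda>x. x \<in> A) q)"

lemma avoids_small_filter_sum_left:
  assumes "avoids_small q" "v \<noteq> bot" "eventually (\<lambda>y. y \<in> R) v"
  shows "avoids_small (filter_sum q v)"
  unfolding avoids_small_def
proof (intro allI impI)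
  fix A assume "small A"
  then have "small {u. eventually (\<lambda>y. u + y \<in> A) v}"
    by (rule small_eventually_translate[OF _ assms(2,3)])
  with assms(1) show "\<not> eventually (\<lambda>x. x \<in> A) (filter_sum q v)"
    by (force simp: avoids_small_def eventually_filter_sum)
qed

lemma avoids_small_filter_sum_right:
  assumes "avoids_small q" "v \<noteq> bot" "eventually (\<lambda>x. x \<in> R) v"
  shows "avoids_small (filter_sum v q)"
  unfolding avoids_small_def
proof (intro allI impI notI)
  fix A assume A: "small A" and "eventually (\<lambda>x. x \<in> A) (filter_sum v q)"
  then have "eventually (\<lambda>x. eventually (\<lambda>y. x + y \<in> A) q) v" by (simp add: eventually_filter_sum)
  with assms(3) have "eventually (\<lambda>x. False) v"
  proof eventually_elim
    fix x assume x: "x \<in> R" "eventually (\<lambda>y. x + y \<in> A) q"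
    then have "eventually (\<lambda>y. y \<in> {u. u + x \<in> A}) q" by (simp add: add.commute)
    with small_translate[OF A x(1)] assms(1) show False by (auto simp: avoids_small_def)
  qed
  with assms(2) show False by simp
qed

lemma filter_sum_list_in_carrier:
  "us \<noteq> [] \<Longrightarrow> (\<And>u. u \<in> set us \<Longrightarrow> eventually (\<lambda>x. x \<in> R) u) \<Longrightarrow>
    eventually (\<lambda>x. x \<in> R) (filter_sum_list us)"
proof (induction us rule: filter_sum_list.induct)
  case (3 u v us)
  have u: "eventually (\<lambda>x. x \<in> R) u" using 3 by simp
  have v: "eventually (\<lambda>x. x \<in> R) (filter_sum_list (v # us))" using 3 by simp
  from u have "\<forall>\<^sub>F x in u. \<forall>\<^sub>F y in filter_sum_list (v # us). x + y \<in> R"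
    by (rule eventually_mono) (use v closed in \<open>auto elim: eventually_mono\<close>)
  then show ?case by (simp add: eventually_filter_sum)
qed auto

lemma avoids_small_filter_sum_list:
  assumes "q \<in> set us" "avoids_small q"
    and "\<And>u. u \<in> set us \<Longrightarrow> ultrafilter u"
    and "\<And>u. u \<in> set us \<Longrightarrow> eventually (\<lambda>x. x \<in> R) u"
  shows "avoids_small (filter_sum_list us)"
  using assms
proof (induction us rule: filter_sum_list.induct)
  case (3 u v us)
  let ?w = "filter_sum_list (v # us)"
  have w: "?w \<noteq> bot" "eventually (\<lambda>x. x \<in> R) ?w"
    using ultrafilter_filter_sum_list[of "v # us"] filter_sum_list_in_carrier[of "v # us"] 3
    by (auto simp: ultrafilter_def)
  have u: "u \<noteq> bot" "eventually (\<lambda>x. x \<in> R) u" using 3 by (auto simp: ultrafilter_def)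
  show ?case
  proof (cases "q = u")
    case True then show ?thesis using avoids_small_filter_sum_left[of u ?w] w 3 by simp
  next
    case False then show ?thesis using avoids_small_filter_sum_right[of ?w u] u 3 by simp
  qed
qed auto

text \<open>
  Adding a fixed \<open>i \<in> I\<close> pushes witnesses from \<open>R\<close> into \<open>I\<close>. It is needed once for the elements of
  \<open>G\<close> and once for the translating element \<open>x\<close>, which is why thickness is applied to \<open>i + i + E\<close>.
\<close>

lemma piecewise_syndetic_in_ideal:
  assumes ps: "piecewise_syndetic_in R A" and I: "I \<subseteq> R" "I \<noteq> {}"
    and ideal: "\<And>i x. i \<in> I \<Longrightarrow> x \<in> R \<Longrightarrow> i + x \<in> I"
  shows "piecewise_syndetic_in I (A \<inter> I)"
proof -
  obtain i where i: "i \<in> I" using I by blast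
  obtain G where G: "finite G" "G \<noteq> {}" "G \<subseteq> R" and thick: "thick_in R (\<Union>t\<in>G. translate_back R t A)"
    using ps by (auto simp: piecewise_syndetic_in_def)
  let ?G = "(\<lambda>g. i + g) ` G"
  have "thick_in I (\<Union>t\<in>?G. translate_back I t (A \<inter> I))"
    unfolding thick_in_def
  proof (intro conjI allI impI, goal_cases)
    case 1 show ?case by (auto simp: translate_back_def)
  next
    case (2 E)
    let ?E = "(\<lambda>e. i + (i + e)) ` E"
    have "finite ?E" "?E \<noteq> {}" "?E \<subseteq> R" using 2 I i by (auto intro!: closed)
    then obtain x where x: "x \<in> R" "(\<lambda>e. e + x) ` ?E \<subseteq> (\<Union>t\<in>G. translate_back R t A)"
      using thick unfolding thick_in_def by meson
    have "e + (i + x) \<in> (\<Union>t\<in>?G. translate_back I t (A \<inter> I))" if e: "e \<in> E" for e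
    proof -
      obtain g where g: "g \<in> G" "g + (i + (i + e) + x) \<in> A"
        using x(2) e by (auto simp: translate_back_def)
      have "g + (i + (i + e) + x) = (i + g) + (e + (i + x))" by (simp add: ac_simps)
      moreover have "e + (i + x) \<in> I" "(i + g) + (e + (i + x)) \<in> I"
        using 2 e g(1) G i I x(1) by (auto intro!: ideal closed)
      ultimately show ?thesis using g by (auto simp: translate_back_def)
    qed
    moreover have "i + x \<in> I" using ideal i x by blast
    ultimately show ?case by blast
  qed
  moreover have "finite ?G" "?G \<noteq> {}" "?G \<subseteq> I" using G i ideal by auto
  ultimately show ?thesis unfolding piecewise_syndetic_in_def by blast
qed

end

lemma filtermap_filter_sum_list:
  assumes hom: "\<And>x y. x \<in> R \<Longrightarrow> y \<in> R \<Longrightarrow> f (x + y) = f x + f y"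
    and R: "comm_subsemigroup R"
    and "us \<noteq> []" "\<And>u. u \<in> set us \<Longrightarrow> eventually (\<lambda>x. x \<in> R) u"
  shows "filtermap f (filter_sum_list us) = filter_sum_list (map (filtermap f) us)"
  using assms(3,4)
proof (induction us rule: filter_sum_list.induct)
  case (3 u v us)
  let ?w = "filter_sum_list (v # us)"
  have u: "eventually (\<lambda>x. x \<in> R) u" using 3 by simp
  have w: "eventually (\<lambda>x. x \<in> R) ?w"
    using comm_subsemigroup.filter_sum_list_in_carrier[OF R, of "v # us"] 3 by simp
  have inner: "(\<forall>\<^sub>F y in ?w. P (f (x + y))) \<longleftrightarrow> (\<forall>\<^sub>F y in ?w. P (f x + f y))" if "x \<in> R" for x P
    by (rule eventually_cong[OF w]) (simp add: hom that)
  have "filtermap f (filter_sum u ?w) = filter_sum (filtermap f u) (filtermap f ?w)"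
    unfolding filter_eq_iff eventually_filtermap eventually_filter_sum
    by (intro allI eventually_cong[OF u] inner)
  with 3 show ?case by simp
qed auto


section \<open>Families of retractions onto a common subsemigroup\<close>

locale retraction_family = S: comm_subsemigroup S + R: comm_subsemigroup R
  for S :: "'a::ab_semigroup_add set" and R :: "'b::ab_semigroup_add set" +
  fixes \<delta> :: "'a \<Rightarrow> 'b" and J :: "'i set" and \<phi> :: "'i \<Rightarrow> 'b \<Rightarrow> 'a"
  assumes \<delta>_in: "s \<in> S \<Longrightarrow> \<delta> s \<in> R"
    and \<phi>_in: "f \<in> J \<Longrightarrow> u \<in> R \<Longrightarrow> \<phi> f u \<in> S"
    and \<phi>_add: "f \<in> J \<Longrightarrow> u \<in> R \<Longrightarrow> v \<in> R \<Longrightarrow> \<phi> f (u + v) = \<phi> f u + \<phi> f v"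
    and \<phi>_\<delta>: "f \<in> J \<Longrightarrow> s \<in> S \<Longrightarrow> \<phi> f (\<delta> s) = s"
begin

text \<open>
  A finite family \<open>\<A>\<close> of sets encodes the finite colouring of \<open>S\<close> in which \<open>s\<close> has the colour
  \<open>{C \<in> \<A>. s \<in> C}\<close>. In this encoding the common refinement of two colourings is simply a union.
\<close>

definition monochromatic :: "'i set \<Rightarrow> 'a set set \<Rightarrow> 'b set" where
  "monochromatic F \<A> = {u \<in> R. \<forall>C\<in>\<A>. \<forall>f\<in>F. \<forall>g\<in>F. \<phi> f u \<in> C \<longleftrightarrow> \<phi> g u \<in> C}"

lemma monochromaticD:
  assumes "u \<in> monochromatic F \<A>" "C \<in> \<A>" "f \<in> F" "g \<in> F"
  shows "\<phi> f u \<in> C \<longleftrightarrow> \<phi> g u \<in> C"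
proof -
  have "\<forall>C\<in>\<A>. \<forall>f\<in>F. \<forall>g\<in>F. \<phi> f u \<in> C \<longleftrightarrow> \<phi> g u \<in> C"
    using assms(1) unfolding monochromatic_def by (elim CollectE conjE)
  from bspec[OF bspec[OF bspec[OF this assms(2)] assms(3)] assms(4)] show ?thesis .
qed

text \<open>
  The sets \<open>monochromatic F \<A> - N\<close>, with \<open>\<A>\<close> finite and \<open>N\<close> small, are nonempty and directed
  downwards. An ultrafilter containing all of them has equal images under the maps \<open>\<phi> f\<close>, because
  each single set \<open>C\<close> is already a colouring \<open>{C}\<close>.
\<close>

lemma equalizing_ultrafilter:
  assumes big: "\<And>\<A>. finite \<A> \<Longrightarrow> \<not> R.small (monochromatic F \<A>)"
  obtains q where "ultrafilter q" "eventually (\<lambda>u. u \<in> R) q" "R.avoids_small q"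
    "\<And>f g. f \<in> F \<Longrightarrow> g \<in> F \<Longrightarrow> filtermap (\<phi> f) q = filtermap (\<phi> g) q"
proof -
  let ?I = "{(\<A> :: 'a set set, N). finite \<A> \<and> R.small N}"
  let ?B = "\<lambda>(\<A>, N). monochromatic F \<A> - N"
  obtain q where q: "ultrafilter q" "\<And>i. i \<in> ?I \<Longrightarrow> eventually (\<lambda>x. x \<in> ?B i) q"
  proof (rule ultrafilter_of_base[of ?I ?B])
    show "?I \<noteq> {}" using R.small_empty by auto
  next
    fix i j assume ij: "i \<in> ?I" "j \<in> ?I"
    obtain \<A> N \<A>' N' where [simp]: "i = (\<A>, N)" "j = (\<A>', N')" by (cases i, cases j) auto
    have "(\<A> \<union> \<A>', N \<union> N') \<in> ?I" using ij R.small_Un by auto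
    moreover have "?B (\<A> \<union> \<A>', N \<union> N') \<subseteq> ?B i \<inter> ?B j" by (auto simp: monochromatic_def)
    ultimately show "\<exists>k\<in>?I. ?B k \<subseteq> ?B i \<inter> ?B j" by blast
  next
    fix i assume "i \<in> ?I"
    then show "?B i \<noteq> {}" using big R.small_subset by (auto split: prod.splits)
  qed blast
  have pair: "eventually (\<lambda>x. x \<in> monochromatic F \<A> \<and> x \<notin> N) q" if "finite \<A>" "R.small N" for \<A> N
    using q(2)[of "(\<A>, N)"] that by simp
  show ?thesis
  proof (rule that[OF q(1)])
    show "eventually (\<lambda>u. u \<in> R) q"
      using pair[of "{}" "{}"] R.small_empty by (auto simp: monochromatic_def elim: eventually_mono)
    show "R.avoids_small q"
      unfolding R.avoids_small_def
    proof (intro allI impI)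
      fix A assume "R.small A"
      then have "eventually (\<lambda>x. x \<notin> A) q" using pair[of "{}" A] by (auto elim: eventually_mono)
      then show "\<not> eventually (\<lambda>x. x \<in> A) q" using ultrafilter_not_eventually[OF q(1)] by blast
    qed
    fix f g assume fg: "f \<in> F" "g \<in> F"
    have "eventually P (filtermap (\<phi> f) q) = eventually P (filtermap (\<phi> g) q)" for P
    proof -
      have "eventually (\<lambda>x. x \<in> monochromatic F {{s. P s}}) q"
        using pair[of "{{s. P s}}" "{}"] R.small_empty by simp
      then have "eventually (\<lambda>x. P (\<phi> f x) = P (\<phi> g x)) q"
        by (rule eventually_mono) (use monochromaticD[OF _ singletonI fg] in fast)
      then show ?thesis unfolding eventually_filtermap by (rule eventually_cong) simp
    qed
    then show "filtermap (\<phi> f) q = filtermap (\<phi> g) q" by (simp add: filter_eq_iff)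
  qed
qed

text \<open>
  The induction step is a pigeonhole argument on the colours of \<open>r + 1\<close> sums of ultrafilters, where
  \<open>r\<close> is the number of possible colours. Two sums of equal colour are the images of one
  ultrafilter \<open>v\<close> that avoids small sets, the first under the new map and the second under all
  the old ones.
\<close>

lemma monochromatic_not_small:
  assumes "finite F" "F \<noteq> {}" "F \<subseteq> J" "finite \<A>"
  shows "\<not> R.small (monochromatic F \<A>)"
  using assms
proof (induction F arbitrary: \<A> rule: finite_ne_induct)
  case (singleton f)
  have "monochromatic {f} \<A> = R" by (auto simp: monochromatic_def)
  then show ?case using R.not_small_carrier by simp
next
  case (insert f0 F)
  from insert.prems have J: "f0 \<in> J" "F \<subseteq> J" by auto
  obtain q where q: "ultrafilter q" "eventually (\<lambda>u. u \<in> R) q" "R.avoids_small q"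
    and eq: "\<And>f g. f \<in> F \<Longrightarrow> g \<in> F \<Longrightarrow> filtermap (\<phi> f) q = filtermap (\<phi> g) q"
    using equalizing_ultrafilter insert.IH J(2) by blast
  obtain f1 where f1: "f1 \<in> F" using insert.hyps by blast
  define p where "p = filtermap (\<phi> f1) q"
  define p' where "p' = filtermap (\<phi> f0) q"
  have p: "ultrafilter p" "ultrafilter p'" "eventually (\<lambda>s. s \<in> S) p" "eventually (\<lambda>s. s \<in> S) p'"
    using q J f1 \<phi>_in unfolding p_def p'_def
    by (auto simp: ultrafilter_filtermap eventually_filtermap subset_iff elim!: eventually_mono)
  define r where "r = card (Pow \<A>)"
  define w where "w j = filter_sum_list (replicate j p @ replicate (r - j) p')" for j
  define colour where "colour j = {C \<in> \<A>. eventually (\<lambda>s. s \<in> C) (w j)}" for j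
  have "\<not> inj_on colour {..r}"
  proof
    assume "inj_on colour {..r}"
    moreover have "colour ` {..r} \<subseteq> Pow \<A>" by (auto simp: colour_def)
    ultimately have "card {..r} \<le> card (Pow \<A>)" using insert.prems by (intro card_inj_on_le) auto
    then show False by (simp add: r_def)
  qed
  then obtain j l where jl: "j < l" "l \<le> r" "colour j = colour l"
    by (auto simp: inj_on_def) (metis linorder_neqE_nat)
  \<comment> \<open>On positions \<open>j\<close> to \<open>l\<close>, where the words of \<open>w j\<close> and \<open>w l\<close> differ, \<open>q\<close> maps to \<open>p'\<close> under
    \<open>\<phi> f0\<close> and to \<open>p\<close> under the maps from \<open>F\<close>; elsewhere the common section gives the shared letter.\<close>
  define us where
    "us = replicate j (filtermap \<delta> p) @ replicate (l - j) q @ replicate (r - l) (filtermap \<delta> p')"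
  define v where "v = filter_sum_list us"
  have us: "us \<noteq> []" "q \<in> set us" using jl by (auto simp: us_def)
  have us_ultra: "ultrafilter u" and us_R: "eventually (\<lambda>x. x \<in> R) u" if "u \<in> set us" for u
    using that p q \<delta>_in unfolding us_def
    by (auto simp: ultrafilter_filtermap eventually_filtermap elim!: eventually_mono split: if_splits)
  have v: "ultrafilter v" "R.avoids_small v" "eventually (\<lambda>x. x \<in> R) v"
    using ultrafilter_filter_sum_list R.avoids_small_filter_sum_list R.filter_sum_list_in_carrier
      us us_ultra us_R q(3) unfolding v_def by blast+
  have retract: "filtermap (\<phi> f) (filtermap \<delta> x) = x" if "f \<in> J" "eventually (\<lambda>s. s \<in> S) x" for f x
    unfolding filter_eq_iff eventually_filtermap
    by (intro allI eventually_cong[OF that(2)]) (simp add: \<phi>_\<delta> that(1))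
  have v_map: "filtermap (\<phi> f) v = filter_sum_list (map (filtermap (\<phi> f)) us)" if "f \<in> J" for f
    unfolding v_def using that us(1) us_R \<phi>_add
    by (intro filtermap_filter_sum_list[OF _ R.comm_subsemigroup_axioms]) auto
  have v_f0: "filtermap (\<phi> f0) v = w j"
    unfolding v_map[OF J(1)] w_def us_def using jl J p
    by (simp add: retract p'_def[symmetric] replicate_add[symmetric])
  have v_F: "filtermap (\<phi> f) v = w l" if f: "f \<in> F" for f
  proof -
    have fJ: "f \<in> J" using f J by blast
    have "filtermap (\<phi> f) q = p" using eq[OF f f1] by (simp add: p_def)
    then have "map (filtermap (\<phi> f)) us = (replicate j p @ replicate (l - j) p) @ replicate (r - l) p'"
      unfolding us_def using p fJ by (simp add: retract)
    also have "replicate j p @ replicate (l - j) p = replicate l p"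
      using jl by (simp add: replicate_add[symmetric])
    finally show ?thesis unfolding v_map[OF fJ] w_def by simp
  qed
  have ev: "eventually (\<lambda>u. \<phi> f u \<in> C \<longleftrightarrow> C \<in> colour l) v" if f: "f \<in> insert f0 F" and C: "C \<in> \<A>" for f C
  proof -
    have "eventually (\<lambda>u. \<phi> f u \<in> C) v \<longleftrightarrow> C \<in> colour l"
    proof (cases "f = f0")
      case True
      have "eventually (\<lambda>u. \<phi> f u \<in> C) v \<longleftrightarrow> eventually (\<lambda>s. s \<in> C) (filtermap (\<phi> f0) v)"
        by (simp add: True eventually_filtermap)
      also have "\<dots> \<longleftrightarrow> C \<in> colour j" by (simp add: v_f0 colour_def C)
      finally show ?thesis by (simp add: jl(3))
    next
      case False
      have "eventually (\<lambda>u. \<phi> f u \<in> C) v \<longleftrightarrow> eventually (\<lambda>s. s \<in> C) (filtermap (\<phi> f) v)"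
        by (simp add: eventually_filtermap)
      also have "\<dots> \<longleftrightarrow> C \<in> colour l" using False f v_F by (simp add: colour_def C)
      finally show ?thesis .
    qed
    then show ?thesis using ultrafilter_not_eventually[OF v(1), of "\<lambda>u. \<phi> f u \<in> C"]
      by (cases "C \<in> colour l") auto
  qed
  have "eventually (\<lambda>u. \<forall>C\<in>\<A>. \<forall>f\<in>insert f0 F. \<phi> f u \<in> C \<longleftrightarrow> C \<in> colour l) v"
    using ev insert.prems insert.hyps by (intro eventually_ball_finite ballI) auto
  with v(3) have "eventually (\<lambda>u. u \<in> monochromatic (insert f0 F) \<A>) v"
    by eventually_elim (auto simp: monochromatic_def)
  with v(2) show ?case by (auto simp: R.avoids_small_def)
qed

text \<open>
  Thickness of \<open>T\<close> supplies an ultrafilter \<open>p\<close> for which every \<open>s + y\<close> with \<open>s \<in> S\<close> lies in \<open>T\<close>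
  for most \<open>y\<close>. It turns the covering of \<open>T\<close> by the sets \<open>-t + M\<close> into the sets \<open>C t\<close> covering the
  whole of \<open>S\<close>, and \<open>monochromatic_not_small\<close> applies to this colouring. The union of the sets \<open>D t\<close>
  below is small if \<open>?B\<close> is, yet it contains all monochromatic elements.
\<close>

theorem piecewise_syndetic_common_preimage:
  assumes F: "finite F" "F \<noteq> {}" "F \<subseteq> J" and M: "piecewise_syndetic_in S M"
  shows "piecewise_syndetic_in R {u \<in> R. \<forall>f\<in>F. \<phi> f u \<in> M}"
proof (rule ccontr)
  let ?B = "{u \<in> R. \<forall>f\<in>F. \<phi> f u \<in> M}"
  assume nps: "\<not> piecewise_syndetic_in R ?B"
  have "?B \<subseteq> R" by blast
  from iffD1[OF R.not_piecewise_syndetic_iff_small[OF this] nps] have small: "R.small ?B" .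
  obtain G where G: "finite G" "G \<subseteq> S" and thick: "thick_in S (\<Union>t\<in>G. translate_back S t M)"
    using M by (auto simp: piecewise_syndetic_in_def)
  define T where "T = (\<Union>t\<in>G. translate_back S t M)"
  let ?I = "{X. finite X \<and> X \<subseteq> S}"
  let ?Y = "\<lambda>X. {y \<in> S. \<forall>s\<in>X. s + y \<in> T}"
  obtain p where p: "ultrafilter p" "\<And>X. X \<in> ?I \<Longrightarrow> eventually (\<lambda>y. y \<in> ?Y X) p"
  proof (rule ultrafilter_of_base[of ?I ?Y])
    fix X Y assume "X \<in> ?I" "Y \<in> ?I"
    then show "\<exists>Z\<in>?I. ?Y Z \<subseteq> ?Y X \<inter> ?Y Y" by (intro bexI[of _ "X \<union> Y"]) auto
  next
    fix X assume X: "X \<in> ?I"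
    obtain c where c: "c \<in> S" using S.nonempty by blast
    have "finite (insert c X)" "insert c X \<noteq> {}" "insert c X \<subseteq> S" using X c by auto
    then obtain y where "y \<in> S" "(\<lambda>s. s + y) ` insert c X \<subseteq> T"
      using thick unfolding thick_in_def T_def by meson
    then show "?Y X \<noteq> {}" by auto
  qed auto
  have pS: "eventually (\<lambda>y. y \<in> S) p"
    using p(2)[of "{}"] by simp
  define C where "C t = {s. eventually (\<lambda>y. t + (s + y) \<in> M) p}" for t
  have cover: "\<exists>t\<in>G. s \<in> C t" if "s \<in> S" for s
  proof -
    have "eventually (\<lambda>y. \<exists>t\<in>G. t + (s + y) \<in> M) p"
      using p(2)[of "{s}"] that by (auto simp: T_def translate_back_def elim!: eventually_mono)
    then show ?thesis
      unfolding C_def using ultrafilter_finite_Bex[OF p(1) G(1)] by fastforce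
  qed
  let ?p = "filtermap \<delta> p"
  have dp: "?p \<noteq> bot" "eventually (\<lambda>x. x \<in> R) ?p"
    using p(1) pS \<delta>_in by (auto simp: ultrafilter_def filtermap_bot_iff eventually_filtermap elim!: eventually_mono)
  define D where "D t = {u. eventually (\<lambda>y. u + y \<in> {x. x + \<delta> t \<in> ?B}) ?p}" for t
  have "R.small (D t)" if "t \<in> G" for t
    unfolding D_def using that G \<delta>_in small
    by (intro R.small_eventually_translate R.small_translate dp) auto
  then have "R.small (\<Union>t\<in>G. D t)" using G(1) by (rule R.small_UN[rotated])
  moreover have "monochromatic F (C ` G) \<subseteq> (\<Union>t\<in>G. D t)"
  proof
    fix u assume u: "u \<in> monochromatic F (C ` G)"
    then have uR: "u \<in> R" by (simp add: monochromatic_def)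
    obtain f1 where f1: "f1 \<in> F" using F by blast
    then have "\<phi> f1 u \<in> S" using \<phi>_in uR F by blast
    then obtain t where t: "t \<in> G" "\<phi> f1 u \<in> C t" using cover by blast
    have "\<phi> f u \<in> C t" if "f \<in> F" for f
    proof -
      have "\<phi> f u \<in> C t \<longleftrightarrow> \<phi> f1 u \<in> C t"
        using monochromaticD[OF u imageI[OF t(1)] that f1] .
      with t(2) show ?thesis by blast
    qed
    then have "eventually (\<lambda>y. \<forall>f\<in>F. t + (\<phi> f u + y) \<in> M) p"
      using F(1) by (simp add: C_def eventually_ball_finite)
    with pS have "eventually (\<lambda>y. u + \<delta> y + \<delta> t \<in> ?B) p"
    proof eventually_elim
      fix y assume y: "y \<in> S" "\<forall>f\<in>F. t + (\<phi> f u + y) \<in> M"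
      have tS: "t \<in> S" using t G by blast
      have "\<phi> f (u + \<delta> y + \<delta> t) = t + (\<phi> f u + y)" if "f \<in> F" for f
      proof -
        have "f \<in> J" using that F by blast
        then show ?thesis using uR y(1) tS by (simp add: \<phi>_add \<phi>_\<delta> \<delta>_in R.closed ac_simps)
      qed
      then show "u + \<delta> y + \<delta> t \<in> ?B" using y uR tS by (simp add: \<delta>_in R.closed)
    qed
    then have "u \<in> D t" by (simp add: D_def eventually_filtermap)
    then show "u \<in> (\<Union>t\<in>G. D t)" using t by blast
  qed
  ultimately have "R.small (monochromatic F (C ` G))" by (rule R.small_subset)
  moreover have "\<not> R.small (monochromatic F (C ` G))" using F G by (intro monochromatic_not_small) auto
  ultimately show False by simp
qed

end


section \<open>Homothetic copies\<close>

lemma nsum_Suc_0: "nsum (Suc 0) x = x"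
  by (simp add: nsum_def)

lemma nsum_Suc: "n \<ge> 1 \<Longrightarrow> nsum (Suc n) x = x + nsum n x"
  by (cases n) (auto simp: nsum_def)

lemma nsum_add:
  assumes "m \<ge> 1" "n \<ge> 1"
  shows "nsum (m + n) x = nsum m x + nsum n x"
  using assms by (induction m rule: dec_induct) (simp_all add: nsum_Suc nsum_Suc_0 add.assoc)

lemma nsum_closed:
  assumes "\<And>x y. x \<in> S \<Longrightarrow> y \<in> S \<Longrightarrow> x + y \<in> S" "x \<in> S" "n \<ge> 1"
  shows "nsum n x \<in> S"
  using assms(3) by (induction n rule: dec_induct) (simp_all add: nsum_Suc nsum_Suc_0 assms)

text \<open>
  The value at \<open>n = 0\<close> is set apart because \<open>nsum 0 f = f\<close>; with this choice the map is additive on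
  all pairs, and \<open>a \<mapsto> (a, 0)\<close> is a section.
\<close>

definition shift_by_multiple :: "'a::ab_semigroup_add \<Rightarrow> 'a \<times> nat \<Rightarrow> 'a" where
  "shift_by_multiple f = (\<lambda>(a, n). if n = 0 then a else a + nsum n f)"

lemma shift_by_multiple_add:
  "shift_by_multiple f (u + v) = shift_by_multiple f u + shift_by_multiple f v"
  by (cases u; cases v) (auto simp: shift_by_multiple_def nsum_add ac_simps)

theorem theorem7:
  fixes S F M :: "'a::ab_semigroup_add set"
  assumes "\<And>x y. x \<in> S \<Longrightarrow> y \<in> S \<Longrightarrow> x + y \<in> S"
    and "finite F" and "F \<noteq> {}" and "F \<subseteq> S"
    and "piecewise_syndetic_in S M"
  shows "piecewise_syndetic_in (S \<times> {n::nat. n \<ge> 1})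
           {(a, n). a \<in> S \<and> n \<ge> 1 \<and> (\<lambda>x. a + nsum n x) ` F \<subseteq> M}"
proof -
  let ?R = "S \<times> (UNIV :: nat set)" and ?I = "S \<times> {n::nat. n \<ge> 1}"
  have S: "S \<noteq> {}" using assms by blast
  interpret retraction_family S ?R "\<lambda>a. (a, 0)" S shift_by_multiple
  proof unfold_locales
    fix f :: 'a and u :: "'a \<times> nat"
    assume "f \<in> S" "u \<in> ?R"
    then show "shift_by_multiple f u \<in> S"
      by (auto simp: shift_by_multiple_def intro!: assms(1) nsum_closed)
  next
    fix f :: 'a and u v :: "'a \<times> nat"
    show "shift_by_multiple f (u + v) = shift_by_multiple f u + shift_by_multiple f v"
      by (rule shift_by_multiple_add)
  qed (use S in \<open>auto simp: shift_by_multiple_def intro!: assms(1)\<close>)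
  let ?B = "{u \<in> ?R. \<forall>f\<in>F. shift_by_multiple f u \<in> M}"
  have "piecewise_syndetic_in ?R ?B"
    using assms by (intro piecewise_syndetic_common_preimage)
  then have "piecewise_syndetic_in ?I (?B \<inter> ?I)"
    using S assms(1) by (intro R.piecewise_syndetic_in_ideal) auto
  moreover have "?B \<inter> ?I = {(a, n). a \<in> S \<and> n \<ge> 1 \<and> (\<lambda>x. a + nsum n x) ` F \<subseteq> M}"
    by (auto simp: shift_by_multiple_def)
  ultimately show ?thesis by simp
qed

end
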